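(* Define the sequences $c^{(-1)}=\big(c_{k}^{(-1)}\big)_{k\in\mathbb{N}}$ and, for every fixed $n\in\mathbb{N}$, $c^{(n)}=\big(c_{k}^{(n)}\big)_{k\in\mathbb{N}}$ by $$c_{k}^{(-1)}=\sum_{j=0}^{k}\frac{f_{k+1}^{2}}{f_{j}f_{j+1}},\qquad c_{k}^{(n)}=\begin{cases}0, & 0\leq k\leq n-1,\\ \dfrac{f_{k+1}^{2}}{f_{n}f_{n+1}}, & k\geq n.\end{cases}$$ Then the following statements hold. (a) The sequence $(c^{(n)})_{n=0}^{\infty}$ is a Schauder basis for $c_{0}(\widehat{F})$, and every $x\in c_{0}(\widehat{F})$ has a unique representation $x=\sum_{n=0}^{\infty}\widehat{F}_{n}(x)\,c^{(n)}$. (b) The sequence $(c^{(n)})_{n=-1}^{\infty}$ is a Schauder basis for $c(\widehat{F})$, and every $z=(z_{n})\in c(\widehat{F})$ has a unique representation $z=l\,c^{(-1)}+\sum_{n=0}^{\infty}\big[\widehat{F}_{n}(z)-l\big]c^{(n)}$, where $l=\lim_{n\to\infty}\widehat{F}_{n}(z)$.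
   Context: Let $\mathbb{N}=\{0,1,2,\dots\}$ and let $\omega$ be the vector space of all real sequences $x=(x_k)_{k\in\mathbb{N}}$. The Fibonacci numbers are defined by $f_0=f_1=1$ and $f_n=f_{n-1}+f_{n-2}$ for $n\ge 2$. For $x\in\omega$ the $\widehat{F}$-transform $\widehat{F}x=(\widehat{F}_n(x))_{n\in\mathbb{N}}$ is defined by $\widehat{F}_0(x)=x_0$ and $\widehat{F}_n(x)=\frac{f_n}{f_{n+1}}x_n-\frac{f_{n+1}}{f_n}x_{n-1}$ for $n\ge1$. Let $c_0$ and $c$ be the spaces of null and of convergent sequences, and put $c_0(\widehat{F})=\{x\in\omega:\widehat{F}x\in c_0\}$ and $c(\widehat{F})=\{x\in\omega:\widehat{F}x\in c\}$, both normed by $\|x\|=\|\widehat{F}x\|_\infty=\sup_{n}|\widehat{F}_n(x)|$. A sequence $(b_n)$ in a normed space $X$ is a Schauder basis for $X$ if for every $x\in X$ there is a unique sequence of scalars $(\alpha_n)$ such that $x=\sum_n\alpha_n b_n$, i.e. the partial sums $\sum_{n\le m}\alpha_n b_n$ converge to $x$ in norm as $m\to\infty$. *)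

theory Defs
  imports "HOL-Analysis.Analysis" "HOL-Number_Theory.Fib"
begin

text \<open>The indexing used here is \<open>f\<^sub>0 = f\<^sub>1 = 1\<close>, whereas the library has \<open>fib 0 = 0\<close>.\<close>

definition fibo :: "nat \<Rightarrow> real" where
  "fibo n = real (fib (Suc n))"

lemma fibo_rec: "fibo 0 = 1" "fibo 1 = 1" "n \<ge> 2 \<Longrightarrow> fibo n = fibo (n - 1) + fibo (n - 2)"
proof -
  show "fibo 0 = 1" "fibo 1 = 1" by (simp_all add: fibo_def)
  assume "n \<ge> 2"
  then obtain m where "n = Suc (Suc m)"
    by (metis add_2_eq_Suc le_Suc_ex)
  then show "fibo n = fibo (n - 1) + fibo (n - 2)" by (simp add: fibo_def)
qed

definition Fhat :: "(nat \<Rightarrow> real) \<Rightarrow> nat \<Rightarrow> real" where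
  "Fhat x n = (if n = 0 then x 0
     else fibo n / fibo (n + 1) * x n - fibo (n + 1) / fibo n * x (n - 1))"

definition c0_Fhat :: "(nat \<Rightarrow> real) set" where
  "c0_Fhat = {x. Fhat x \<longlonglongrightarrow> 0}"

definition c_Fhat :: "(nat \<Rightarrow> real) set" where
  "c_Fhat = {x. convergent (Fhat x)}"

text \<open>The supremum is meaningful only when \<open>Fhat x\<close> is bounded, which holds on both spaces.\<close>

definition norm_Fhat :: "(nat \<Rightarrow> real) \<Rightarrow> real" where
  "norm_Fhat x = (SUP n. \<bar>Fhat x n\<bar>)"

text \<open>The vector space operations on sequences are written out pointwise, since the function
  type is not an instance of the class of real vector spaces.\<close>

definition normed_seq_space :: "(nat \<Rightarrow> real) set \<Rightarrow> ((nat \<Rightarrow> real) \<Rightarrow> real) \<Rightarrow> bool" where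
  "normed_seq_space X N \<longleftrightarrow>
     (\<lambda>k. 0) \<in> X \<and>
     (\<forall>x\<in>X. \<forall>y\<in>X. (\<lambda>k. x k + y k) \<in> X \<and> N (\<lambda>k. x k + y k) \<le> N x + N y) \<and>
     (\<forall>a. \<forall>x\<in>X. (\<lambda>k. a * x k) \<in> X \<and> N (\<lambda>k. a * x k) = \<bar>a\<bar> * N x) \<and>
     (\<forall>x\<in>X. N x = 0 \<longleftrightarrow> x = (\<lambda>k. 0))"

definition norm_tendsto ::
    "((nat \<Rightarrow> real) \<Rightarrow> real) \<Rightarrow> (nat \<Rightarrow> nat \<Rightarrow> real) \<Rightarrow> (nat \<Rightarrow> real) \<Rightarrow> bool" where
  "norm_tendsto N s x \<longleftrightarrow> (\<lambda>m. N (\<lambda>k. s m k - x k)) \<longlonglongrightarrow> 0"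

definition schauder_basis ::
    "(nat \<Rightarrow> real) set \<Rightarrow> ((nat \<Rightarrow> real) \<Rightarrow> real) \<Rightarrow> (nat \<Rightarrow> nat \<Rightarrow> real) \<Rightarrow> bool" where
  "schauder_basis X N b \<longleftrightarrow> normed_seq_space X N \<and> (\<forall>n. b n \<in> X) \<and>
     (\<forall>x\<in>X. \<exists>!\<alpha>. norm_tendsto N (\<lambda>m k. \<Sum>n\<le>m. \<alpha> n * b n k) x)"

definition c_minus1 :: "nat \<Rightarrow> real" where
  "c_minus1 k = (\<Sum>j\<le>k. (fibo (k + 1))\<^sup>2 / (fibo j * fibo (j + 1)))"

definition c_seq :: "nat \<Rightarrow> nat \<Rightarrow> real" where
  "c_seq n k = (if k < n then 0 else (fibo (k + 1))\<^sup>2 / (fibo n * fibo (n + 1)))"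

lemma fibo_pos: "fibo n > 0"
  by (simp add: fibo_def fib_neq_0_nat)

lemma Fhat_zero: "Fhat (\<lambda>k. 0) = (\<lambda>n. 0)"
  by (simp add: Fhat_def fun_eq_iff)

lemma Fhat_add: "Fhat (\<lambda>k. x k + y k) = (\<lambda>n. Fhat x n + Fhat y n)"
  by (simp add: Fhat_def fun_eq_iff algebra_simps add_divide_distrib)

lemma Fhat_scale: "Fhat (\<lambda>k. a * x k) = (\<lambda>n. a * Fhat x n)"
  by (simp add: Fhat_def fun_eq_iff algebra_simps add_divide_distrib)

lemma Fhat_eq_0_imp: assumes "\<And>n. Fhat x n = 0" shows "x k = 0"
proof (induction k)
  case 0
  show ?case using assms[of 0] by (simp add: Fhat_def)
next
  case (Suc k)
  then show ?case
    using assms[of "Suc k"] fibo_pos[of "Suc k"] fibo_pos[of "Suc (Suc k)"] by (simp add: Fhat_def)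
qed

lemma bdd_above_Fhat:
  assumes "x \<in> c_Fhat" shows "bdd_above (range (\<lambda>n. \<bar>Fhat x n\<bar>))"
proof -
  have "Bseq (Fhat x)" using assms by (simp add: c_Fhat_def convergent_imp_Bseq)
  then obtain K where "\<And>n. \<bar>Fhat x n\<bar> \<le> K" by (auto simp: Bseq_def)
  then show ?thesis by (intro bdd_aboveI[of _ K]) auto
qed

lemma c0_Fhat_subset: "c0_Fhat \<subseteq> c_Fhat"
  by (auto simp: c0_Fhat_def c_Fhat_def convergent_def)

lemma norm_Fhat_ge: "x \<in> c_Fhat \<Longrightarrow> \<bar>Fhat x n\<bar> \<le> norm_Fhat x"
  unfolding norm_Fhat_def by (rule cSUP_upper) (auto intro: bdd_above_Fhat)

lemma norm_Fhat_le: "(\<And>n. \<bar>Fhat x n\<bar> \<le> K) \<Longrightarrow> norm_Fhat x \<le> K"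
  unfolding norm_Fhat_def by (rule cSUP_least) auto

lemma norm_Fhat_add:
  assumes "x \<in> c_Fhat" "y \<in> c_Fhat"
  shows "norm_Fhat (\<lambda>k. x k + y k) \<le> norm_Fhat x + norm_Fhat y"
proof (rule norm_Fhat_le)
  fix n
  show "\<bar>Fhat (\<lambda>k. x k + y k) n\<bar> \<le> norm_Fhat x + norm_Fhat y"
    using norm_Fhat_ge[OF assms(1), of n] norm_Fhat_ge[OF assms(2), of n]
    by (simp add: Fhat_add)
qed

lemma c_Fhat_scale: "x \<in> c_Fhat \<Longrightarrow> (\<lambda>k. a * x k) \<in> c_Fhat"
  by (auto simp: c_Fhat_def Fhat_scale convergent_def intro!: tendsto_intros)

lemma norm_Fhat_eq_0_iff:
  assumes "x \<in> c_Fhat" shows "norm_Fhat x = 0 \<longleftrightarrow> x = (\<lambda>k. 0)"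
proof
  assume "norm_Fhat x = 0"
  then have "Fhat x n = 0" for n using norm_Fhat_ge[OF assms, of n] by simp
  then show "x = (\<lambda>k. 0)" using Fhat_eq_0_imp by blast
next
  assume "x = (\<lambda>k. 0)"
  then show "norm_Fhat x = 0" by (simp add: norm_Fhat_def Fhat_zero)
qed

lemma norm_Fhat_scale_le:
  assumes "x \<in> c_Fhat" shows "norm_Fhat (\<lambda>k. a * x k) \<le> \<bar>a\<bar> * norm_Fhat x"
  by (rule norm_Fhat_le)
    (simp add: Fhat_scale abs_mult mult_left_mono norm_Fhat_ge[OF assms])

lemma norm_Fhat_scale:
  assumes "x \<in> c_Fhat" shows "norm_Fhat (\<lambda>k. a * x k) = \<bar>a\<bar> * norm_Fhat x"
proof (cases "a = 0")
  case True
  then show ?thesis by (simp add: norm_Fhat_def Fhat_zero)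
next
  case False
  have "norm_Fhat (\<lambda>k. inverse a * (a * x k)) \<le> \<bar>inverse a\<bar> * norm_Fhat (\<lambda>k. a * x k)"
    by (rule norm_Fhat_scale_le[OF c_Fhat_scale[OF assms]])
  moreover have "(\<lambda>k. inverse a * (a * x k)) = x" using False by (simp add: fun_eq_iff)
  ultimately have "\<bar>a\<bar> * norm_Fhat x \<le> norm_Fhat (\<lambda>k. a * x k)"
    using False by (simp add: field_simps)
  then show ?thesis using norm_Fhat_scale_le[OF assms, of a] by simp
qed

lemma normed_seq_space_c_Fhat: "normed_seq_space c_Fhat norm_Fhat"
proof -
  have "(\<lambda>k. x k + y k) \<in> c_Fhat" if "x \<in> c_Fhat" "y \<in> c_Fhat" for x y
    using that by (auto simp: c_Fhat_def Fhat_add intro: convergent_add)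
  moreover have "(\<lambda>k. 0) \<in> c_Fhat"
    by (simp add: c_Fhat_def Fhat_zero convergent_const)
  ultimately show ?thesis
    by (simp add: normed_seq_space_def norm_Fhat_add norm_Fhat_scale norm_Fhat_eq_0_iff
        c_Fhat_scale)
qed

lemma normed_seq_space_c0_Fhat: "normed_seq_space c0_Fhat norm_Fhat"
proof -
  have "(\<lambda>k. x k + y k) \<in> c0_Fhat" if "x \<in> c0_Fhat" "y \<in> c0_Fhat" for x y
    using that tendsto_add[of "Fhat x" 0 sequentially "Fhat y" 0]
    by (simp add: c0_Fhat_def Fhat_add)
  moreover have "(\<lambda>k. a * x k) \<in> c0_Fhat" if "x \<in> c0_Fhat" for a x
    using that tendsto_mult_left[of "Fhat x" 0 sequentially a]
    by (simp add: c0_Fhat_def Fhat_scale)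
  moreover have "(\<lambda>k. 0) \<in> c0_Fhat"
    by (simp add: c0_Fhat_def Fhat_zero)
  ultimately show ?thesis
    using c0_Fhat_subset
    by (auto simp: normed_seq_space_def norm_Fhat_add norm_Fhat_scale norm_Fhat_eq_0_iff
        subset_iff)
qed

end

theory Submission
  imports Defs
begin

text \<open>The map \<open>Fhat\<close> is linear and injective, and \<open>norm_Fhat\<close> is the supremum norm carried back
  along it. It sends \<open>c_seq n\<close> to the \<open>n\<close>-th unit sequence and \<open>c_minus1\<close> to the constant
  sequence \<open>1\<close>, because dividing by \<open>f\<^bsub>k+1\<^esub>\<^sup>2\<close> turns \<open>Fhat\<close> into a weighted difference operator
  (lemma \<open>Fhat_square_mult\<close>). Both parts are thus the classical facts that the unit sequences,
  without or with the constant sequence, form a Schauder basis of the null or of the convergent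
  sequences.

  The two classical facts have one common source. A partial sum of \<open>a e + (\<Sum>n. \<alpha> n e\<^sub>n)\<close> takes
  the value \<open>a + \<alpha> n\<close> for \<open>n \<le> m\<close> and \<open>a\<close> afterwards. Uniform convergence to a sequence \<open>y\<close> with
  limit \<open>l\<close> forces \<open>y n = a + \<alpha> n\<close> by looking at single positions and \<open>a = l\<close> by looking at the
  tail; conversely, with these coefficients the error is the tail \<open>l - y n\<close> for \<open>n > m\<close>, which is
  uniformly small. This is \<open>uniform_limit_partial_sums_iff\<close>. The case of \<open>c\<^sub>0\<close> is \<open>a = l = 0\<close>.\<close>

section \<open>The transform as a linear isometry\<close>

lemma Fhat_diff: "Fhat (\<lambda>k. x k - y k) = (\<lambda>n. Fhat x n - Fhat y n)"
  using Fhat_add[of x "\<lambda>k. (- 1) * y k"] Fhat_scale[of "- 1" y] by simp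

lemma Fhat_sum:
  "Fhat (\<lambda>k. \<Sum>n\<le>(m::nat). \<alpha> n * b n k) = (\<lambda>j. \<Sum>n\<le>m. \<alpha> n * Fhat (b n) j)"
  by (induction m) (simp_all add: Fhat_scale Fhat_add)

lemma c_Fhat_diff:
  assumes "x \<in> c_Fhat" "y \<in> c_Fhat" shows "(\<lambda>k. x k - y k) \<in> c_Fhat"
  using assms by (auto simp: c_Fhat_def Fhat_diff intro: convergent_diff)

lemma norm_tendsto_iff_uniform_limit:
  assumes "\<And>m. s m \<in> c_Fhat" "x \<in> c_Fhat"
  shows "norm_tendsto norm_Fhat s x \<longleftrightarrow>
    uniform_limit UNIV (\<lambda>m. Fhat (s m)) (Fhat x) sequentially"
proof -
  define d where "d m = (\<lambda>k. s m k - x k)" for m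
  have d: "d m \<in> c_Fhat" for m
    unfolding d_def by (intro c_Fhat_diff assms)
  have Fd: "Fhat (d m) n = Fhat (s m) n - Fhat x n" for m n
    by (simp add: d_def Fhat_diff)
  have ge: "\<bar>Fhat (s m) n - Fhat x n\<bar> \<le> norm_Fhat (d m)" for m n
    using norm_Fhat_ge[OF d, of m n] by (simp add: Fd)
  have nonneg: "0 \<le> norm_Fhat (d m)" for m
    using ge[of m 0] by linarith
  have "(\<lambda>m. norm_Fhat (d m)) \<longlonglongrightarrow> 0 \<longleftrightarrow>
    uniform_limit UNIV (\<lambda>m. Fhat (s m)) (Fhat x) sequentially"
  proof
    assume L: "(\<lambda>m. norm_Fhat (d m)) \<longlonglongrightarrow> 0"
    show "uniform_limit UNIV (\<lambda>m. Fhat (s m)) (Fhat x) sequentially"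
    proof (rule uniform_limitI)
      fix e :: real assume "e > 0"
      with L have "\<forall>\<^sub>F m in sequentially. norm_Fhat (d m) < e"
        by (rule order_tendstoD)
      then show "\<forall>\<^sub>F m in sequentially. \<forall>n\<in>UNIV. dist (Fhat (s m) n) (Fhat x n) < e"
        by eventually_elim (auto simp: dist_real_def intro: le_less_trans[OF ge])
    qed
  next
    assume L: "uniform_limit UNIV (\<lambda>m. Fhat (s m)) (Fhat x) sequentially"
    show "(\<lambda>m. norm_Fhat (d m)) \<longlonglongrightarrow> 0"
    proof (rule tendstoI)
      fix e :: real assume e: "e > 0"
      \<comment> \<open>Strict bounds on the entries give only a weak bound on their supremum, hence \<open>e / 2\<close>.\<close>
      then have "\<forall>\<^sub>F m in sequentially. \<forall>n\<in>UNIV. dist (Fhat (s m) n) (Fhat x n) < e / 2"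
        by (intro uniform_limitD[OF L]) simp
      then show "\<forall>\<^sub>F m in sequentially. dist (norm_Fhat (d m)) 0 < e"
      proof eventually_elim
        case (elim m)
        then have "norm_Fhat (d m) \<le> e / 2"
          by (intro norm_Fhat_le) (auto simp: Fd dist_real_def intro: less_imp_le)
        then show ?case using e nonneg[of m] by simp
      qed
    qed
  qed
  then show ?thesis
    by (simp add: norm_tendsto_def d_def)
qed

section \<open>Images of the basis sequences\<close>

text \<open>The substitution \<open>x\<^sub>k = f\<^bsub>k+1\<^esub>\<^sup>2 u\<^sub>k\<close> makes the coefficients of \<open>x\<^sub>k\<close> and \<open>x\<^bsub>k-1\<^esub>\<close> equal up to
  sign. This explains both families of basis sequences: a step function \<open>u\<close> gives
  \<open>c_seq n\<close>, and their sum gives \<open>c_minus1\<close>.\<close>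

lemma Fhat_square_mult:
  assumes x: "\<And>k. x k = (fibo (k + 1))\<^sup>2 * u k"
  shows "Fhat x n = fibo n * fibo (n + 1) * (u n - (if n = 0 then 0 else u (n - 1)))"
proof (cases n)
  case 0
  then show ?thesis by (simp add: Fhat_def x fibo_def)
next
  case (Suc p)
  then show ?thesis
    using fibo_pos[of "Suc p"] fibo_pos[of "Suc (Suc p)"]
    by (simp add: Fhat_def x power2_eq_square field_simps)
qed

lemma Fhat_c_seq: "Fhat (c_seq n) = (\<lambda>j. if j = n then 1 else 0)"
proof
  fix j
  define u where "u k = (if k < n then 0 else 1 / (fibo n * fibo (n + 1)))" for k
  have "Fhat (c_seq n) j = fibo j * fibo (j + 1) * (u j - (if j = 0 then 0 else u (j - 1)))"
    by (rule Fhat_square_mult) (simp add: c_seq_def u_def)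
  also have "u j - (if j = 0 then 0 else u (j - 1)) =
      (if j = n then 1 / (fibo n * fibo (n + 1)) else 0)"
    by (cases j) (auto simp: u_def)
  finally show "Fhat (c_seq n) j = (if j = n then 1 else 0)"
    using fibo_pos[of n] fibo_pos[of "Suc n"] by simp
qed

lemma Fhat_c_minus1: "Fhat c_minus1 = (\<lambda>j. 1)"
proof
  fix j
  define u where "u k = (\<Sum>i\<le>k. 1 / (fibo i * fibo (i + 1)))" for k
  have "Fhat c_minus1 j = fibo j * fibo (j + 1) * (u j - (if j = 0 then 0 else u (j - 1)))"
    by (rule Fhat_square_mult) (simp add: c_minus1_def u_def sum_distrib_left)
  also have "u j - (if j = 0 then 0 else u (j - 1)) = 1 / (fibo j * fibo (j + 1))"
    by (cases j) (simp_all add: u_def)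
  finally show "Fhat c_minus1 j = 1"
    using fibo_pos[of j] fibo_pos[of "Suc j"] by simp
qed

lemma c_seq_in_c0_Fhat: "c_seq n \<in> c0_Fhat"
proof -
  have "\<forall>\<^sub>F j in sequentially. (if j = n then 1 else 0) = (0::real)"
    using eventually_gt_at_top[of n] by eventually_elim simp
  then show ?thesis
    by (simp add: c0_Fhat_def Fhat_c_seq tendsto_eventually)
qed

lemma c_minus1_in_c_Fhat: "c_minus1 \<in> c_Fhat"
  by (simp add: c_Fhat_def Fhat_c_minus1 convergent_const)

lemma Fhat_partial_sum:
  "Fhat (\<lambda>k. a * c_minus1 k + (\<Sum>n\<le>m. \<alpha> n * c_seq n k)) =
    (\<lambda>j. a + (if j \<le> m then \<alpha> j else 0))"
proof
  fix j
  have "(\<Sum>n\<le>m. \<alpha> n * (if j = n then 1 else 0)) = (\<Sum>n\<le>m. if j = n then \<alpha> n else 0)"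
    by (intro sum.cong) auto
  then show "Fhat (\<lambda>k. a * c_minus1 k + (\<Sum>n\<le>m. \<alpha> n * c_seq n k)) j =
      a + (if j \<le> m then \<alpha> j else 0)"
    by (simp add: Fhat_add Fhat_scale Fhat_sum Fhat_c_minus1 Fhat_c_seq)
qed

lemma partial_sum_in_c_Fhat:
  "(\<lambda>k. a * c_minus1 k + (\<Sum>n\<le>m. \<alpha> n * c_seq n k)) \<in> c_Fhat"
proof -
  have "\<forall>\<^sub>F j in sequentially. a + (if j \<le> m then \<alpha> j else 0) = a"
    using eventually_gt_at_top[of m] by eventually_elim simp
  then show ?thesis
    unfolding c_Fhat_def mem_Collect_eq Fhat_partial_sum
    by (intro convergentI[of _ a] tendsto_eventually)
qed

section \<open>Expansions along the basis\<close>

lemma uniform_limit_partial_sums_iff: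
  fixes y \<alpha> :: "nat \<Rightarrow> real"
  assumes y: "y \<longlonglongrightarrow> l"
  shows "uniform_limit UNIV (\<lambda>m j. a + (if j \<le> m then \<alpha> j else 0)) y sequentially \<longleftrightarrow>
    a = l \<and> \<alpha> = (\<lambda>n. y n - l)" (is "?U \<longleftrightarrow> _")
proof
  assume U: ?U
  have "y n = a + \<alpha> n" for n
  proof -
    have "(\<lambda>m. a + (if n \<le> m then \<alpha> n else 0)) \<longlonglongrightarrow> y n"
      using tendsto_uniform_limitI[OF U, of n] by simp
    moreover have "\<forall>\<^sub>F m in sequentially. a + (if n \<le> m then \<alpha> n else 0) = a + \<alpha> n"
      using eventually_ge_at_top[of n] by eventually_elim simp
    then have "(\<lambda>m. a + (if n \<le> m then \<alpha> n else 0)) \<longlonglongrightarrow> a + \<alpha> n"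
      by (rule tendsto_eventually)
    ultimately show ?thesis by (rule LIMSEQ_unique)
  qed
  moreover have "y \<longlonglongrightarrow> a"
  proof (rule tendstoI)
    fix e :: real assume "e > 0"
    from uniform_limitD[OF U this] obtain m where
      m: "\<And>j. dist (a + (if j \<le> m then \<alpha> j else 0)) (y j) < e"
      by (auto simp: eventually_sequentially)
    \<comment> \<open>Beyond position \<open>m\<close> the \<open>m\<close>-th partial sum is constantly \<open>a\<close>.\<close>
    have "dist (y j) a < e" if "j > m" for j
      using m[of j] that by (simp add: dist_commute)
    then show "\<forall>\<^sub>F j in sequentially. dist (y j) a < e"
      by (rule eventually_mono[OF eventually_gt_at_top[of m]])
  qed
  then have "a = l" using y by (rule LIMSEQ_unique)
  ultimately show "a = l \<and> \<alpha> = (\<lambda>n. y n - l)" by (simp add: fun_eq_iff)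
next
  assume A: "a = l \<and> \<alpha> = (\<lambda>n. y n - l)"
  show ?U
  proof (rule uniform_limitI)
    fix e :: real assume e: "e > 0"
    then obtain M where M: "\<And>j. j \<ge> M \<Longrightarrow> dist (y j) l < e"
      using y unfolding lim_sequentially by blast
    have "dist (a + (if j \<le> m then \<alpha> j else 0)) (y j) < e" if "m \<ge> M" for m j
      using M[of j] A e that by (auto simp: dist_commute)
    then show "\<forall>\<^sub>F m in sequentially. \<forall>j\<in>UNIV.
        dist (a + (if j \<le> m then \<alpha> j else 0)) (y j) < e"
      by (intro eventually_mono[OF eventually_ge_at_top[of M]] ballI)
  qed
qed

lemma norm_tendsto_partial_sums_iff:
  assumes "Fhat z \<longlonglongrightarrow> l"
  shows "norm_tendsto norm_Fhat (\<lambda>m k. a * c_minus1 k + (\<Sum>n\<le>m. \<alpha> n * c_seq n k)) z \<longleftrightarrow>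
    a = l \<and> \<alpha> = (\<lambda>n. Fhat z n - l)"
proof -
  have "z \<in> c_Fhat" using assms by (auto simp: c_Fhat_def convergent_def)
  then show ?thesis
    using uniform_limit_partial_sums_iff[OF assms]
    by (simp add: norm_tendsto_iff_uniform_limit partial_sum_in_c_Fhat Fhat_partial_sum)
qed

lemma norm_tendsto_c_seq_iff:
  assumes "x \<in> c0_Fhat"
  shows "norm_tendsto norm_Fhat (\<lambda>m k. \<Sum>n\<le>m. \<alpha> n * c_seq n k) x \<longleftrightarrow> \<alpha> = Fhat x"
  using norm_tendsto_partial_sums_iff[of x 0 0 \<alpha>] assms by (simp add: c0_Fhat_def)

lemma norm_tendsto_c_minus1_c_seq_iff:
  assumes "z \<in> c_Fhat"
  shows "norm_tendsto norm_Fhat (\<lambda>m k. a * c_minus1 k + (\<Sum>n\<le>m. \<alpha> n * c_seq n k)) z \<longleftrightarrow>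
    a = lim (Fhat z) \<and> \<alpha> = (\<lambda>n. Fhat z n - lim (Fhat z))"
  using assms by (intro norm_tendsto_partial_sums_iff) (simp add: c_Fhat_def convergent_LIMSEQ_iff)

text \<open>Placing \<open>c_minus1\<close> at index \<open>0\<close> shifts the partial sums by one position, which does not
  affect their limit.\<close>

lemma norm_tendsto_case_nat_iff:
  "norm_tendsto N (\<lambda>m k. \<Sum>n\<le>m. \<beta> n * case_nat b0 b n k) z \<longleftrightarrow>
    norm_tendsto N (\<lambda>m k. \<beta> 0 * b0 k + (\<Sum>n\<le>m. \<beta> (Suc n) * b n k)) z"
proof -
  define g where "g m = N (\<lambda>k. (\<Sum>n\<le>m. \<beta> n * case_nat b0 b n k) - z k)" for m
  have "g (Suc m) = N (\<lambda>k. \<beta> 0 * b0 k + (\<Sum>n\<le>m. \<beta> (Suc n) * b n k) - z k)" for m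
    unfolding g_def by (subst sum.atMost_Suc_shift) simp
  then show ?thesis
    using filterlim_sequentially_Suc[of g "nhds 0"] by (simp add: norm_tendsto_def g_def)
qed

lemma schauder_basis_c0_Fhat: "schauder_basis c0_Fhat norm_Fhat c_seq"
  by (simp add: schauder_basis_def normed_seq_space_c0_Fhat c_seq_in_c0_Fhat
      norm_tendsto_c_seq_iff)

lemma schauder_basis_c_Fhat: "schauder_basis c_Fhat norm_Fhat (case_nat c_minus1 c_seq)"
  unfolding schauder_basis_def
proof (intro conjI allI ballI)
  show "normed_seq_space c_Fhat norm_Fhat" by (rule normed_seq_space_c_Fhat)
  show "case_nat c_minus1 c_seq n \<in> c_Fhat" for n
    using c_seq_in_c0_Fhat c0_Fhat_subset c_minus1_in_c_Fhat by (auto split: nat.split)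
  fix z assume z: "z \<in> c_Fhat"
  define \<gamma> where "\<gamma> = case_nat (lim (Fhat z)) (\<lambda>n. Fhat z n - lim (Fhat z))"
  have "norm_tendsto norm_Fhat (\<lambda>m k. \<Sum>n\<le>m. \<beta> n * case_nat c_minus1 c_seq n k) z \<longleftrightarrow>
      \<beta> = \<gamma>" for \<beta>
    unfolding norm_tendsto_case_nat_iff norm_tendsto_c_minus1_c_seq_iff[OF z]
    by (auto simp: \<gamma>_def fun_eq_iff split: nat.split)
  then show "\<exists>!\<beta>. norm_tendsto norm_Fhat
      (\<lambda>m k. \<Sum>n\<le>m. \<beta> n * case_nat c_minus1 c_seq n k) z"
    by simp
qed

theorem corollary3p8:
  shows "(schauder_basis c0_Fhat norm_Fhat c_seq \<and>
      (\<forall>x\<in>c0_Fhat. \<forall>\<alpha>.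
         norm_tendsto norm_Fhat (\<lambda>m k. \<Sum>n\<le>m. \<alpha> n * c_seq n k) x
           \<longleftrightarrow> \<alpha> = Fhat x))
    \<and>
    (schauder_basis c_Fhat norm_Fhat (case_nat c_minus1 c_seq) \<and>
      (\<forall>z\<in>c_Fhat. \<forall>a \<alpha>.
         norm_tendsto norm_Fhat (\<lambda>m k. a * c_minus1 k + (\<Sum>n\<le>m. \<alpha> n * c_seq n k)) z
           \<longleftrightarrow> a = lim (Fhat z) \<and> \<alpha> = (\<lambda>n. Fhat z n - lim (Fhat z))))"
  by (intro conjI ballI allI schauder_basis_c0_Fhat schauder_basis_c_Fhat
      norm_tendsto_c_seq_iff norm_tendsto_c_minus1_c_seq_iff)

end
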